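(* Let $q$ be a prime power, let $n>k\ge 2$ be integers, and let $G\in\mathbb{F}_q^{k\times n}$ be a matrix of rank $k$ with no zero column. Let $d^\perp$ be the minimum distance of the dual of the code generated by $G$ and let $s_i$ denote the number of systematic nodes for the $i$-th object, for $i\in\{1,\ldots,k\}$. For all $(\lambda_1,\ldots,\lambda_k)\in\Lambda(G)$ we have $$\sum_{\substack{i\in\{1,\ldots,k\}\\ s_i\ne 0}}\Bigl(\min\{s_i,\lambda_i\}+\max\{2,d^\perp-1\}\max\{0,\lambda_i-s_i\}\Bigr)+\sum_{\substack{i\in\{1,\ldots,k\}\\ s_i=0}}2\lambda_i\le n.$$
   Context: The code generated by $G$ is the row space $\mathcal{C}\le\mathbb{F}_q^n$ of $G$; its dual is $\mathcal{C}^\perp=\{x\in\mathbb{F}_q^n\mid xy^\top=0\text{ for all }y\in\mathcal{C}\}$. The minimum distance of a code is the minimum Hamming weight (number of nonzero entries) of its nonzero vectors. Let $G^\nu$ denote the $\nu$-th column of $G$ and $e_i$ the $i$-th standard basis vector of $\mathbb{F}_q^k$. An index $\nu\in\{1,\ldots,n\}$ is a systematic node for the $i$-th object if $G^\nu$ is a nonzero multiple of $e_i$. For $i\in\{1,\ldots,k\}$ let $\mathcal{R}_i^{\mathrm{all}}(G)=\{R\subseteq\{1,\ldots,n\}\mid e_i\in\langle G^\nu\mid\nu\in R\rangle\}$, where $\langle\cdot\rangle$ is the $\mathbb{F}_q$-span. The service rate region $\Lambda(G)\subseteq\mathbb{R}^k$ (with server capacity $1$) is the set of all $(\lambda_1,\ldots,\lambda_k)\in\mathbb{R}^k$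 for which there exist real numbers $\lambda_{i,R}\ge 0$ ($i\in\{1,\ldots,k\}$, $R\in\mathcal{R}_i^{\mathrm{all}}(G)$) with $\sum_{R\in\mathcal{R}_i^{\mathrm{all}}(G)}\lambda_{i,R}=\lambda_i$ for all $i$, and $\sum_{i=1}^k\sum_{R\in\mathcal{R}_i^{\mathrm{all}}(G),\,\nu\in R}\lambda_{i,R}\le 1$ for all $\nu\in\{1,\ldots,n\}$. *)

theory Defs
  imports "HOL-Analysis.Analysis"
begin

text \<open>
  Coordinates $1, \ldots, n$ and objects $1, \ldots, k$ are the elements of finite index types
  \<^typ>\<open>'n\<close> and \<^typ>\<open>'k\<close>; a $k \times n$ matrix has type \<^typ>\<open>'a^'n^'k\<close> and \<open>axis i 1\<close> is $e_i$.
  A finite field $F_q$ is a type of sort \<open>{field, finite}\<close>.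
\<close>

definition row_space :: "'a::field^'n^'k \<Rightarrow> ('a^'n) set"
  where "row_space G = vec.span (rows G)"

text \<open>The library's inner product exists only over the reals, so the standard bilinear form on
  \<open>'a^'n\<close> is written out.\<close>

definition dual_code :: "('a::field^'n) set \<Rightarrow> ('a^'n) set"
  where "dual_code C = {x. \<forall>y\<in>C. (\<Sum>\<nu>\<in>UNIV. x $ \<nu> * y $ \<nu>) = 0}"

definition hamming_weight :: "'a::zero^'n \<Rightarrow> nat"
  where "hamming_weight x = card {\<nu>. x $ \<nu> \<noteq> 0}"

text \<open>Meaningful only for codes containing a nonzero vector (\<^const>\<open>Min\<close> of the empty set is
  unspecified); the dual of the row space of a $k \times n$ matrix with $k < n$ is such a code.\<close>

definition minimum_distance :: "('a::zero^'n) set \<Rightarrow> nat"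
  where "minimum_distance C = Min (hamming_weight ` (C - {0}))"

definition systematic_node :: "'a::field^'n^'k \<Rightarrow> 'k \<Rightarrow> 'n \<Rightarrow> bool"
  where "systematic_node G i \<nu> \<longleftrightarrow> (\<exists>c. c \<noteq> 0 \<and> column \<nu> G = c *s axis i 1)"

definition num_systematic :: "'a::field^'n^'k \<Rightarrow> 'k \<Rightarrow> nat"
  where "num_systematic G i = card {\<nu>. systematic_node G i \<nu>}"

definition recovery_sets :: "'a::field^'n^'k \<Rightarrow> 'k \<Rightarrow> 'n set set"
  where "recovery_sets G i = {R. axis i 1 \<in> vec.span ((\<lambda>\<nu>. column \<nu> G) ` R)}"

definition service_rate_region :: "'a::field^'n^'k \<Rightarrow> (real^'k) set"
  where "service_rate_region G =
    {l. \<exists>a :: 'k \<Rightarrow> 'n set \<Rightarrow> real.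
          (\<forall>i. \<forall>R\<in>recovery_sets G i. a i R \<ge> 0) \<and>
          (\<forall>i. (\<Sum>R\<in>recovery_sets G i. a i R) = l $ i) \<and>
          (\<forall>\<nu>. (\<Sum>i\<in>UNIV. \<Sum>R\<in>{R \<in> recovery_sets G i. \<nu> \<in> R}. a i R) \<le> 1)}"

end

theory Submission
  imports Defs
begin

text \<open>
  Measure the cost of serving a request from a recovery set \<open>R\<close> by the number \<open>card R\<close> of servers
  that it occupies. Summing the capacity constraints over all nodes, a feasible allocation costs at
  most \<open>CARD('n)\<close> in total, so it suffices to bound the cost of each object \<open>i\<close> from below.

  A recovery set for \<open>i\<close> may be cheap only if it contains a systematic node for \<open>i\<close>. Otherwise it
  has at least two elements, because a single column spanning \<open>e\<^sub>i\<close> would be systematic; and if some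
  systematic node \<open>\<mu>\<close> exists, combining the representation of \<open>e\<^sub>i\<close> over \<open>R\<close> with the one over
  \<open>\<mu>\<close> gives a nonzero word of the dual code supported on \<open>insert \<mu> R\<close>, so that \<open>card R + 1\<close> is at
  least the dual distance
  (\<open>minimum_distance_dual_le_Suc_card_recovery_set\<close>).
  The systematic nodes have total capacity \<open>s\<^sub>i\<close>, hence at most \<open>s\<^sub>i\<close> units of the demand \<open>\<lambda>\<^sub>i\<close> are
  served cheaply, and each remaining unit pays the higher price
  (\<open>allocation_cost_lower_bound\<close>).
\<close>

section \<open>Recovery sets and the dual code\<close>

lemma matrix_vector_mult_axis:
  fixes G :: "'a::field^'n^'k"
  shows "G *v axis \<nu> 1 = column \<nu> G"
  by (simp add: vec_eq_iff matrix_vector_mult_def column_def axis_def if_distrib cong: if_cong)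

text \<open>Distinct indices may carry equal columns, so the coefficients are supported on a set of
  representatives inside \<open>R\<close>.\<close>

lemma span_columns_imp_supported_solution:
  fixes G :: "'a::field^'n^'k"
  assumes "v \<in> vec.span ((\<lambda>\<nu>. column \<nu> G) ` R)"
  obtains x where "G *v x = v" and "{\<nu>. x $ \<nu> \<noteq> 0} \<subseteq> R"
proof -
  let ?col = "\<lambda>\<nu>. column \<nu> G"
  obtain T where T: "T \<subseteq> R" "inj_on ?col T" "?col ` R = ?col ` T"
    using subset_image_inj[of "?col ` R" ?col R] by auto
  obtain u where "v = (\<Sum>w\<in>?col ` T. u w *s w)"
    using assms T(3) by (auto simp: vec.span_finite)
  then have v: "v = (\<Sum>\<nu>\<in>T. u (column \<nu> G) *s column \<nu> G)"
    using T(2) by (simp add: sum.reindex)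
  define x where "x = (\<chi> \<nu>. if \<nu> \<in> T then u (column \<nu> G) else 0)"
  have "G *v x = (\<Sum>\<nu>\<in>UNIV. x $ \<nu> *s column \<nu> G)"
    by (rule matrix_mult_sum)
  also have "\<dots> = (\<Sum>\<nu>\<in>T. x $ \<nu> *s column \<nu> G)"
    by (rule sum.mono_neutral_right) (auto simp: x_def)
  also have "\<dots> = v"
    unfolding v by (rule sum.cong) (auto simp: x_def)
  finally have "G *v x = v" .
  moreover have "{\<nu>. x $ \<nu> \<noteq> 0} \<subseteq> R"
    using T(1) by (auto simp: x_def)
  ultimately show ?thesis
    by (rule that)
qed

lemma kernel_imp_dual_code:
  fixes G :: "'a::field^'n^'k"
  assumes "G *v x = 0"
  shows "x \<in> dual_code (row_space G)"
proof -
  have "(\<Sum>\<nu>\<in>UNIV. x $ \<nu> * y $ \<nu>) = 0" if "y \<in> vec.span (rows G)" for y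
    using that
  proof (induction rule: vec.span_induct_alt)
    case base
    show ?case by simp
  next
    case (step c r y)
    obtain i where r: "r = row i G"
      using step(1) by (auto simp: rows_def)
    have "(\<Sum>\<nu>\<in>UNIV. x $ \<nu> * r $ \<nu>) = (G *v x) $ i"
      by (simp add: r row_def matrix_vector_mult_def mult.commute)
    then have "(\<Sum>\<nu>\<in>UNIV. x $ \<nu> * r $ \<nu>) = 0"
      using assms by simp
    moreover have "(\<Sum>\<nu>\<in>UNIV. x $ \<nu> * (c *s r + y) $ \<nu>)
        = c * (\<Sum>\<nu>\<in>UNIV. x $ \<nu> * r $ \<nu>) + (\<Sum>\<nu>\<in>UNIV. x $ \<nu> * y $ \<nu>)"
      by (simp add: sum.distrib sum_distrib_left algebra_simps)
    ultimately show ?case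
      using step by simp
  qed
  then show ?thesis
    by (simp add: dual_code_def row_space_def)
qed

lemma minimum_distance_le_hamming_weight:
  fixes C :: "('a::zero^'n) set"
  assumes "x \<in> C" and "x \<noteq> 0"
  shows "minimum_distance C \<le> hamming_weight x"
proof -
  have "hamming_weight ` (C - {0}) \<subseteq> {..CARD('n)}"
    by (auto simp: hamming_weight_def intro: card_mono)
  then have "finite (hamming_weight ` (C - {0}))"
    by (rule finite_subset) simp
  then show ?thesis
    unfolding minimum_distance_def using assms by (intro Min_le) auto
qed

text \<open>A solution of \<open>G *v x = e\<^sub>i\<close> whose support has at most one element would make that element
  a systematic node.\<close>

lemma card_recovery_set_ge_2:
  fixes G :: "'a::field^'n^'k"
  assumes "R \<in> recovery_sets G i" and "\<And>\<nu>. \<nu> \<in> R \<Longrightarrow> \<not> systematic_node G i \<nu>"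
  shows "2 \<le> card R"
proof (rule ccontr)
  assume "\<not> 2 \<le> card R"
  then have "card R = 0 \<or> card R = 1"
    by linarith
  then have "R = {} \<or> (\<exists>\<nu>. R = {\<nu>})"
    by (auto simp: card_1_singleton_iff)
  then obtain \<nu> where "R \<subseteq> {\<nu>}"
    by auto
  have "axis i 1 \<in> vec.span ((\<lambda>\<nu>. column \<nu> G) ` R)"
    using assms(1) by (simp add: recovery_sets_def)
  then obtain x where x: "G *v x = axis i 1" "{\<nu>. x $ \<nu> \<noteq> 0} \<subseteq> R"
    by (rule span_columns_imp_supported_solution)
  have "x $ \<nu> *s axis \<nu> 1 = x"
    using x(2) \<open>R \<subseteq> {\<nu>}\<close> by (auto simp: vec_eq_iff axis_def)
  then have "axis i 1 = G *v (x $ \<nu> *s axis \<nu> 1)"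
    using x(1) by simp
  also have "\<dots> = x $ \<nu> *s column \<nu> G"
    by (simp only: vector_scalar_commute matrix_vector_mult_axis)
  finally have eq: "axis i 1 = x $ \<nu> *s column \<nu> G" .
  have "x $ \<nu> \<noteq> 0"
    using eq by (metis axis_eq_0_iff vector_smult_lzero zero_neq_one)
  then have "column \<nu> G = inverse (x $ \<nu>) *s axis i 1"
    unfolding eq by (simp add: vector_smult_assoc)
  then have "systematic_node G i \<nu>"
    using \<open>x $ \<nu> \<noteq> 0\<close> unfolding systematic_node_def by (metis inverse_nonzero_iff_nonzero)
  moreover have "\<nu> \<in> R"
    using x(2) \<open>x $ \<nu> \<noteq> 0\<close> by auto
  ultimately show False
    using assms(2) by blast
qed

text \<open>Two representations of \<open>e\<^sub>i\<close>, one over \<open>R\<close> and one over the node \<open>\<mu>\<close> outside \<open>R\<close>, differ by a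
  nonzero dual codeword.\<close>

lemma minimum_distance_dual_le_Suc_card_recovery_set:
  fixes G :: "'a::field^'n^'k"
  assumes "R \<in> recovery_sets G i" and "systematic_node G i \<mu>" and "\<mu> \<notin> R"
  shows "minimum_distance (dual_code (row_space G)) \<le> Suc (card R)"
proof -
  have "axis i 1 \<in> vec.span ((\<lambda>\<nu>. column \<nu> G) ` R)"
    using assms(1) by (simp add: recovery_sets_def)
  then obtain x where x: "G *v x = axis i 1" "{\<nu>. x $ \<nu> \<noteq> 0} \<subseteq> R"
    by (rule span_columns_imp_supported_solution)
  obtain c where c: "c \<noteq> 0" "column \<mu> G = c *s axis i 1"
    using assms(2) by (auto simp: systematic_node_def)
  define z where "z = c *s x - axis \<mu> 1"
  have "G *v z = 0"
    using x(1) c(2)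
    by (simp add: z_def matrix_vector_mult_diff_distrib vector_scalar_commute
        matrix_vector_mult_axis)
  then have "z \<in> dual_code (row_space G)"
    by (rule kernel_imp_dual_code)
  moreover have "x $ \<mu> = 0"
    using x(2) assms(3) by auto
  then have "z $ \<mu> = -1"
    by (simp add: z_def)
  then have "z \<noteq> 0"
    by auto
  ultimately have "minimum_distance (dual_code (row_space G)) \<le> hamming_weight z"
    by (rule minimum_distance_le_hamming_weight)
  also have "{\<nu>. z $ \<nu> \<noteq> 0} \<subseteq> insert \<mu> R"
    using x(2) by (auto simp: z_def axis_def)
  then have "hamming_weight z \<le> card (insert \<mu> R)"
    unfolding hamming_weight_def by (intro card_mono) auto
  also have "\<dots> = Suc (card R)"
    using assms(3) by simp
  finally show ?thesis .
qed

section \<open>The cost of an allocation\<close>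

text \<open>Exchanging the order of summation: a set \<open>R\<close> is charged once for each of its elements.\<close>

lemma sum_load_eq_sum_card_Int:
  fixes a :: "'n::finite set \<Rightarrow> real"
  shows "(\<Sum>\<nu>\<in>S. \<Sum>R\<in>{R \<in> F. \<nu> \<in> R}. a R) = (\<Sum>R\<in>F. real (card (R \<inter> S)) * a R)"
proof -
  have "(\<Sum>\<nu>\<in>S. \<Sum>R\<in>{R \<in> F. \<nu> \<in> R}. a R) = (\<Sum>R\<in>F. \<Sum>\<nu>\<in>{\<nu> \<in> S. \<nu> \<in> R}. a R)"
    by (rule sum.swap_restrict) auto
  also have "\<dots> = (\<Sum>R\<in>F. real (card (R \<inter> S)) * a R)"
  proof (rule sum.cong)
    fix R
    have "{\<nu> \<in> S. \<nu> \<in> R} = R \<inter> S"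
      by auto
    then show "(\<Sum>\<nu>\<in>{\<nu> \<in> S. \<nu> \<in> R}. a R) = real (card (R \<inter> S)) * a R"
      by simp
  qed simp
  finally show ?thesis .
qed

text \<open>At most \<open>card S\<close> units of the weight \<open>a\<close> sit on sets that meet \<open>S\<close>, since each of these
  units loads some element of \<open>S\<close>. Such sets cost at least 1 per unit and all others at least
  \<open>D \<ge> 1\<close>, so the cost is smallest when the cheap weight is as large as possible.\<close>

lemma allocation_cost_lower_bound:
  fixes a :: "'n::finite set \<Rightarrow> real" and D :: real
  assumes nonneg: "\<And>R. R \<in> F \<Longrightarrow> 0 \<le> a R"
    and load: "\<And>\<nu>. \<nu> \<in> S \<Longrightarrow> (\<Sum>R\<in>{R \<in> F. \<nu> \<in> R}. a R) \<le> 1"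
    and "1 \<le> D"
    and far: "\<And>R. R \<in> F \<Longrightarrow> R \<inter> S = {} \<Longrightarrow> D \<le> real (card R)"
  shows "min (real (card S)) (sum a F) + D * max 0 (sum a F - real (card S))
    \<le> (\<Sum>R\<in>F. real (card R) * a R)"
proof -
  define A where "A = {R \<in> F. R \<inter> S \<noteq> {}}"
  define B where "B = {R \<in> F. R \<inter> S = {}}"
  have split: "sum f F = sum f A + sum f B" for f :: "'n set \<Rightarrow> real"
  proof -
    have "F = A \<union> B" "A \<inter> B = {}"
      by (auto simp: A_def B_def)
    then show ?thesis
      by (simp add: sum.union_disjoint)
  qed
  have card_pos: "1 \<le> real (card (R \<inter> S))" if "R \<in> A" for R
  proof -
    have "0 < card (R \<inter> S)"
      using that by (simp add: A_def card_gt_0_iff)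
    then show ?thesis
      by simp
  qed
  have "sum a A \<le> (\<Sum>R\<in>A. real (card (R \<inter> S)) * a R)"
  proof (rule sum_mono)
    fix R assume "R \<in> A"
    then have "1 * a R \<le> real (card (R \<inter> S)) * a R"
      by (intro mult_right_mono card_pos) (auto simp: A_def nonneg)
    then show "a R \<le> real (card (R \<inter> S)) * a R"
      by simp
  qed
  also have "\<dots> \<le> (\<Sum>R\<in>F. real (card (R \<inter> S)) * a R)"
    by (rule sum_mono2) (auto simp: A_def nonneg)
  also have "\<dots> = (\<Sum>\<nu>\<in>S. \<Sum>R\<in>{R \<in> F. \<nu> \<in> R}. a R)"
    by (rule sum_load_eq_sum_card_Int[symmetric])
  also have "\<dots> \<le> (\<Sum>\<nu>\<in>S. 1)"
    by (rule sum_mono) (rule load)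
  finally have near_le: "sum a A \<le> real (card S)"
    by simp
  have cost_A: "sum a A \<le> (\<Sum>R\<in>A. real (card R) * a R)"
  proof (rule sum_mono)
    fix R assume "R \<in> A"
    then have "1 \<le> real (card R)"
      using card_pos[of R] card_mono[of R "R \<inter> S"] by auto
    then have "1 * a R \<le> real (card R) * a R"
      using \<open>R \<in> A\<close> by (intro mult_right_mono) (auto simp: A_def nonneg)
    then show "a R \<le> real (card R) * a R"
      by simp
  qed
  have "D * sum a B \<le> (\<Sum>R\<in>B. real (card R) * a R)"
    unfolding sum_distrib_left
    by (intro sum_mono mult_right_mono) (auto simp: B_def far nonneg)
  then have "sum a A + D * sum a B \<le> (\<Sum>R\<in>F. real (card R) * a R)"
    using cost_A split[of "\<lambda>R. real (card R) * a R"] by simp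
  moreover have "min (real (card S)) (sum a F) + D * max 0 (sum a F - real (card S))
      \<le> sum a A + D * sum a B"
  proof -
    define m where "m = min (real (card S)) (sum a F)"
    have "0 \<le> sum a B"
      by (rule sum_nonneg) (simp add: B_def nonneg)
    then have "sum a A \<le> m"
      using near_le split[of a] by (simp add: m_def)
    then have "0 \<le> (D - 1) * (m - sum a A)"
      using \<open>1 \<le> D\<close> by simp
    then have "m + D * (sum a F - m) \<le> sum a A + D * sum a B"
      unfolding split[of a] by (simp add: algebra_simps)
    moreover have "max 0 (sum a F - real (card S)) = sum a F - m"
      by (simp add: m_def min_def max_def)
    ultimately show ?thesis
      unfolding m_def by simp
  qed
  ultimately show ?thesis
    by linarith
qed

section \<open>The bound on the service rate region\<close>

theorem theorem5p7:
  fixes G :: "'a::{field,finite}^'n^'k" and l :: "real^'k"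
  assumes "CARD('k) \<ge> 2" and "CARD('n) > CARD('k)"
    and "rank G = CARD('k)"
    and "\<And>\<nu>. column \<nu> G \<noteq> 0"
    and "l \<in> service_rate_region G"
  shows "(\<Sum>i\<in>{i. num_systematic G i \<noteq> 0}.
            min (real (num_systematic G i)) (l $ i)
            + max 2 (real (minimum_distance (dual_code (row_space G))) - 1)
              * max 0 (l $ i - real (num_systematic G i)))
         + (\<Sum>i\<in>{i. num_systematic G i = 0}. 2 * l $ i)
         \<le> real CARD('n)"
proof -
  let ?d = "minimum_distance (dual_code (row_space G))"
  let ?F = "recovery_sets G"
  obtain a where nonneg: "\<And>i R. R \<in> ?F i \<Longrightarrow> 0 \<le> a i R"
    and demand: "\<And>i. sum (a i) (?F i) = l $ i"
    and capacity: "\<And>\<nu>. (\<Sum>i\<in>UNIV. \<Sum>R\<in>{R \<in> ?F i. \<nu> \<in> R}. a i R) \<le> 1"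
    using assms(5) unfolding service_rate_region_def by auto
  define cost where "cost i = (\<Sum>R\<in>?F i. real (card R) * a i R)" for i
  let ?S = "\<lambda>i. {\<nu>. systematic_node G i \<nu>}"
  have load: "(\<Sum>R\<in>{R \<in> ?F i. \<nu> \<in> R}. a i R) \<le> 1" for i \<nu>
  proof -
    have "(\<Sum>R\<in>{R \<in> ?F i. \<nu> \<in> R}. a i R) \<le> (\<Sum>i\<in>UNIV. \<Sum>R\<in>{R \<in> ?F i. \<nu> \<in> R}. a i R)"
      by (rule member_le_sum) (auto intro: sum_nonneg nonneg)
    then show ?thesis
      using capacity[of \<nu>] by linarith
  qed
  have systematic: "min (real (num_systematic G i)) (l $ i)
      + max 2 (real ?d - 1) * max 0 (l $ i - real (num_systematic G i)) \<le> cost i"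
    if "num_systematic G i \<noteq> 0" for i
  proof -
    obtain \<mu> where \<mu>: "systematic_node G i \<mu>"
      using \<open>num_systematic G i \<noteq> 0\<close> by (auto simp: num_systematic_def)
    have "max 2 (real ?d - 1) \<le> real (card R)" if "R \<in> ?F i" "R \<inter> ?S i = {}" for R
    proof -
      have "2 \<le> card R"
        using that by (intro card_recovery_set_ge_2) auto
      moreover have "?d \<le> Suc (card R)"
        using that \<mu> by (intro minimum_distance_dual_le_Suc_card_recovery_set) auto
      ultimately show ?thesis
        by simp
    qed
    then show ?thesis
      using allocation_cost_lower_bound[where F = "?F i" and a = "a i" and S = "?S i"
          and D = "max 2 (real ?d - 1)"]
      by (simp add: cost_def demand num_systematic_def nonneg load)
  qed
  have nonsystematic: "2 * l $ i \<le> cost i" if "num_systematic G i = 0" for i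
  proof -
    have "?S i = {}"
      using that by (simp add: num_systematic_def)
    then have "2 \<le> card R" if "R \<in> ?F i" for R
      using that by (intro card_recovery_set_ge_2) auto
    then have "2 * a i R \<le> real (card R) * a i R" if "R \<in> ?F i" for R
      using that by (intro mult_right_mono) (auto simp: nonneg)
    then show ?thesis
      unfolding cost_def demand[symmetric] sum_distrib_left by (rule sum_mono)
  qed
  have "(\<Sum>i\<in>UNIV. cost i) = (\<Sum>i\<in>UNIV. \<Sum>\<nu>\<in>UNIV. \<Sum>R\<in>{R \<in> ?F i. \<nu> \<in> R}. a i R)"
    by (simp add: cost_def sum_load_eq_sum_card_Int)
  also have "\<dots> = (\<Sum>\<nu>\<in>UNIV. \<Sum>i\<in>UNIV. \<Sum>R\<in>{R \<in> ?F i. \<nu> \<in> R}. a i R)"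
    by (rule sum.swap)
  also have "\<dots> \<le> (\<Sum>\<nu>\<in>(UNIV :: 'n set). 1)"
    by (rule sum_mono) (rule capacity)
  finally have total: "(\<Sum>i\<in>UNIV. cost i) \<le> real CARD('n)"
    by simp
  have "sum cost UNIV = sum cost ({i. num_systematic G i \<noteq> 0} \<union> {i. num_systematic G i = 0})"
    by (rule arg_cong[where f = "sum cost"]) auto
  also have "\<dots> = sum cost {i. num_systematic G i \<noteq> 0} + sum cost {i. num_systematic G i = 0}"
    by (rule sum.union_disjoint) auto
  finally have "sum cost {i. num_systematic G i \<noteq> 0} + sum cost {i. num_systematic G i = 0}
      \<le> real CARD('n)"
    using total by simp
  moreover have "(\<Sum>i\<in>{i. num_systematic G i \<noteq> 0}. min (real (num_systematic G i)) (l $ i)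
      + max 2 (real ?d - 1) * max 0 (l $ i - real (num_systematic G i)))
      \<le> sum cost {i. num_systematic G i \<noteq> 0}"
    by (rule sum_mono) (simp add: systematic)
  moreover have "(\<Sum>i\<in>{i. num_systematic G i = 0}. 2 * l $ i)
      \<le> sum cost {i. num_systematic G i = 0}"
    by (rule sum_mono) (simp add: nonsystematic)
  ultimately show ?thesis
    by linarith
qed

end
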